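(* Assume that for every $x\in\mathcal M^B$ the operator $L_x=BP_xB^*:\mathcal Y\to\mathcal Y$ is invertible. Then $\mathcal M^B=(B|_{\mathcal M})^{-1}(c)=\mathcal M\cap\{x\in\mathcal E: Bx=c\}$ is a $C^2$ Hilbert submanifold of $\mathcal M$, and hence an embedded Hilbert submanifold of $\mathcal E$. Moreover, for every $x\in\mathcal M^B$, $$T_x\mathcal M^B=\ker\bigl(T_x(B|_{\mathcal M})\bigr)=T_x\mathcal M\cap\ker(B)=T_x\mathcal M\cap\{v\in\mathcal E: Bv=0\}.$$
   Context: $\mathcal E,\mathcal Y$ are real Hilbert spaces. $\mathcal M\subset\mathcal E$ is a $C^2$ embedded submanifold; for $x\in\mathcal M$ the tangent space $T_x\mathcal M$ is identified with a closed linear subspace of $\mathcal E$. $B:\mathcal E\to\mathcal Y$ is a surjective bounded linear operator with adjoint $B^*:\mathcal Y\to\mathcal E$, $c\in\mathcal Y$, and $\mathcal M^B:=\{x\in\mathcal M: Bx=c\}$ is nonempty. For each $x\in\mathcal M$ a bounded linear projection $P_x:\mathcal E\to T_x\mathcal M$ onto $T_x\mathcal M$ is given (surjective onto $T_x\mathcal M$, $P_x^2=P_x$; not necessarily orthogonal). The tangent map of $B|_{\mathcal M}$ at $x$ is $T_x(B|_{\mathcal M})=B|_{T_x\mathcal M}:T_x\mathcal M\to\mathcal Y$. *)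

theory Defs
  imports "HOL-Analysis.Analysis"
begin

definition C2_on :: "('a::real_normed_vector \<Rightarrow> 'b::real_normed_vector) \<Rightarrow> 'a set \<Rightarrow> bool" where
  "C2_on f U \<longleftrightarrow> open U \<and>
     (\<exists>(f' :: 'a \<Rightarrow> 'a \<Rightarrow>\<^sub>L 'b) (f'' :: 'a \<Rightarrow> 'a \<Rightarrow>\<^sub>L ('a \<Rightarrow>\<^sub>L 'b)).
        (\<forall>x\<in>U. (f has_derivative blinfun_apply (f' x)) (at x)) \<and>
        (\<forall>x\<in>U. (f' has_derivative blinfun_apply (f'' x)) (at x)) \<and>
        continuous_on U f'')"

(* C^2 maps on a set that need not be open are the maps with local C^2 extensions to the
   ambient space.  For open S this is the usual notion; for a relatively open subset S of a closed
   subspace F of a Hilbert space it agrees with being C^2 as a map on the Hilbert space F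
   (extend by composing with the orthogonal projection onto F). *)
definition C2_map :: "('a::real_normed_vector \<Rightarrow> 'b::real_normed_vector) \<Rightarrow> 'a set \<Rightarrow> bool" where
  "C2_map f S \<longleftrightarrow> (\<forall>x\<in>S. \<exists>U g. x \<in> U \<and> C2_on g U \<and> (\<forall>y\<in>S \<inter> U. g y = f y))"

definition C2_diffeomorphism ::
  "'a::real_normed_vector set \<Rightarrow> 'b::real_normed_vector set \<Rightarrow> ('a \<Rightarrow> 'b) \<Rightarrow> ('b \<Rightarrow> 'a) \<Rightarrow> bool" where
  "C2_diffeomorphism S T f g \<longleftrightarrow>
     f ` S = T \<and> g ` T = S \<and> (\<forall>x\<in>S. g (f x) = x) \<and> (\<forall>y\<in>T. f (g y) = y) \<and>
     C2_map f S \<and> C2_map g T"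

(* Slice charts: an ambient C^2 chart around each point of M carries M to a piece of a closed
   linear subspace F.  In a Hilbert space F is automatically complemented, so no splitting condition
   is needed.  The subspace may depend on the point. *)
definition C2_embedded_submanifold :: "'a::{real_inner,banach} set \<Rightarrow> bool" where
  "C2_embedded_submanifold M \<longleftrightarrow>
     (\<forall>x\<in>M. \<exists>(U :: 'a set) (V :: 'a set) f g F.
        open U \<and> x \<in> U \<and> open V \<and> C2_diffeomorphism U V f g \<and>
        subspace F \<and> closed F \<and> f ` (M \<inter> U) = F \<inter> V)"

(* A C^2 chart of the (embedded) manifold M around x, with domain D and Hilbert model space F. *)
definition C2_chart_at ::
  "'a::{real_inner,banach} set \<Rightarrow> 'a \<Rightarrow> 'a set \<Rightarrow> 'a set \<Rightarrow> ('a \<Rightarrow> 'a) \<Rightarrow> bool" where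
  "C2_chart_at M x D F f \<longleftrightarrow>
     x \<in> D \<and> openin (top_of_set M) D \<and> subspace F \<and> closed F \<and>
     openin (top_of_set F) (f ` D) \<and> (\<exists>g. C2_diffeomorphism D (f ` D) f g)"

(* N is a submanifold of the manifold M: around each point of N, some chart of M carries N to a piece
   of a closed linear subspace G of the model space of M. *)
definition C2_submanifold_of :: "'a::{real_inner,banach} set \<Rightarrow> 'a set \<Rightarrow> bool" where
  "C2_submanifold_of N M \<longleftrightarrow> N \<subseteq> M \<and>
     (\<forall>x\<in>N. \<exists>D F f G. C2_chart_at M x D F f \<and>
        subspace G \<and> closed G \<and> G \<subseteq> F \<and> f ` (N \<inter> D) = G \<inter> f ` D)"

definition curve_at :: "'a::real_normed_vector set \<Rightarrow> 'a \<Rightarrow> 'a \<Rightarrow> (real \<Rightarrow> 'a) \<Rightarrow> bool" where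
  "curve_at M x v c \<longleftrightarrow>
     (\<exists>e>0. c C1_differentiable_on {-e<..<e} \<and> c ` {-e<..<e} \<subseteq> M) \<and>
     c 0 = x \<and> (c has_vector_derivative v) (at 0)"

(* Tangent vectors are represented by the velocities of curves, i.e. by vectors of the ambient space. *)
definition tangent_space :: "'a::real_normed_vector set \<Rightarrow> 'a \<Rightarrow> 'a set" where
  "tangent_space M x = {v. \<exists>c. curve_at M x v c}"

(* Depends only on the restriction of f to M; meaningful for v in tangent_space M x. *)
definition tangent_map ::
  "'a::real_normed_vector set \<Rightarrow> ('a \<Rightarrow> 'b::real_normed_vector) \<Rightarrow> 'a \<Rightarrow> 'a \<Rightarrow> 'b" where
  "tangent_map M f x v =
     (THE w. \<exists>c. curve_at M x v c \<and> ((\<lambda>t. f (c t)) has_vector_derivative w) (at 0))"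

lemma tangent_map_bounded_linear:
  assumes "bounded_linear B" and "v \<in> tangent_space M x"
  shows "tangent_map M B x v = B v"
proof -
  have *: "((\<lambda>t. B (c t)) has_vector_derivative B v) (at 0)" if "curve_at M x v c" for c
    using that bounded_linear.has_vector_derivative[OF assms(1)] unfolding curve_at_def by blast
  show ?thesis
    unfolding tangent_map_def
  proof (rule the_equality)
    show "\<exists>c. curve_at M x v c \<and> ((\<lambda>t. B (c t)) has_vector_derivative B v) (at 0)"
      using assms(2) * unfolding tangent_space_def by blast
  next
    fix w
    assume "\<exists>c. curve_at M x v c \<and> ((\<lambda>t. B (c t)) has_vector_derivative w) (at 0)"
    then show "w = B v"
      using * vector_derivative_unique_at by blast
  qed
qed

definition tangent_map_kernel ::
  "'a::real_normed_vector set \<Rightarrow> ('a \<Rightarrow> 'b::real_normed_vector) \<Rightarrow> 'a \<Rightarrow> 'a set" where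
  "tangent_map_kernel M f x = {v \<in> tangent_space M x. tangent_map M f x v = 0}"

(* Invertibility of a bounded operator, i.e. existence of a bounded two-sided inverse. *)
definition invertible_operator :: "('a::real_normed_vector \<Rightarrow> 'a) \<Rightarrow> bool" where
  "invertible_operator T \<longleftrightarrow> (\<exists>S. bounded_linear S \<and> S \<circ> T = id \<and> T \<circ> S = id)"

end

theory Submission
  imports Defs
begin

text \<open>
  Invertibility of \<open>B \<circ> P x \<circ> adjoint B\<close>, with inverse \<open>S\<close>, makes \<open>R = P x \<circ> adjoint B \<circ> S\<close> a right
  inverse of \<open>B\<close> with values in the tangent space of \<open>M\<close> at \<open>x\<close>.  It is bounded because the adjoint is
  (\<open>bounded_linear_adjoint\<close>, from the Riesz representation theorem).  So \<open>B\<close> restricted to \<open>M\<close> is a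
  submersion at \<open>x\<close>, with an explicit splitting.

  The submersion is straightened in a single ambient chart (\<open>level_set_slice_chart\<close>).  Given a slice
  chart \<open>f\<close> of \<open>M\<close> with model space \<open>F\<close> and inverse \<open>g\<close>, one composes \<open>f\<close> with
  \<open>\<psi> y = (y - a) + Q (B (g y) - c - A (y - a))\<close>, where \<open>a = f x\<close>, \<open>A\<close> is the derivative of \<open>B \<circ> g\<close> at
  \<open>a\<close>, and \<open>Q\<close> is \<open>R\<close> followed by the derivative of \<open>f\<close> at \<open>x\<close>.  Then \<open>\<psi>\<close> preserves membership in \<open>F\<close>,
  turns the constraint into the linear equation \<open>A z = 0\<close>, and has the identity as derivative at \<open>a\<close>,
  hence is a local \<open>C\<^sup>2\<close> diffeomorphism (\<open>C2_inverse_function\<close>).  The composite is a chart in which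
  \<open>M\<close> is a piece of \<open>F\<close> and the level set is a piece of \<open>G = {z \<in> F. A z = 0}\<close>.

  Both submanifold claims are read off from this chart.  For the tangent spaces, vectors tangent to a
  set at \<open>x\<close> are exactly those that the derivative of a slice chart sends to the model space
  (\<open>tangent_space_slice_chart\<close>).  Since the same chart serves \<open>M\<close> and the level set, the two tangent
  spaces differ exactly by the linear equation \<open>B v = 0\<close>.
\<close>

section \<open>Adjoints of bounded operators on Hilbert spaces\<close>

text \<open>
  The representing vector is the minimizer of \<open>x \<bullet> x - 2 * \<phi> x\<close>.  The parallelogram law makes every
  minimizing sequence Cauchy, so completeness provides the minimizer, and the vanishing of the first
  variation there is the representation.
\<close>

lemma Riesz_representation:
  fixes \<phi> :: "'a::{real_inner,banach} \<Rightarrow> real"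
  assumes "bounded_linear \<phi>"
  obtains z where "\<And>x. \<phi> x = z \<bullet> x"
proof -
  interpret bounded_linear \<phi> by fact
  obtain K where K: "\<And>x. norm (\<phi> x) \<le> norm x * K"
    using bounded by blast
  define J where "J x = x \<bullet> x - 2 * \<phi> x" for x
  define m where "m = Inf (range J)"
  have "- (K\<^sup>2) \<le> J x" for x
  proof -
    have "\<phi> x \<le> norm x * K" using K[of x] by simp
    moreover have "x \<bullet> x = (norm x)\<^sup>2" by (simp add: power2_norm_eq_inner)
    moreover have "0 \<le> (norm x - K)\<^sup>2" by simp
    ultimately show ?thesis unfolding J_def by (simp add: power2_diff)
  qed
  then have bdd: "bdd_below (range J)" by (intro bdd_belowI2)
  then have m: "m \<le> J x" for x unfolding m_def by (simp add: cInf_lower)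
  have "\<exists>x. J x < m + inverse (real (Suc n))" for n
    using cInf_lessD[of "range J" "m + inverse (real (Suc n))"] unfolding m_def by auto
  then obtain X where X: "\<And>n. J (X n) < m + inverse (real (Suc n))" by metis
  \<comment> \<open>The parallelogram law: points with nearly minimal \<open>J\<close> are close to each other.\<close>
  have par: "(norm (x - y))\<^sup>2 = 2 * J x + 2 * J y - 4 * J ((1/2) *\<^sub>R (x + y))" for x y
    unfolding J_def power2_norm_eq_inner
    by (simp add: scaleR add inner_diff inner_add inner_commute algebra_simps)
  have "Cauchy X"
  proof (rule metric_CauchyI)
    fix e :: real assume "0 < e"
    then obtain N where N: "inverse (real (Suc N)) < e\<^sup>2 / 4"
      using reals_Archimedean[of "e\<^sup>2 / 4"] by auto
    have "dist (X i) (X j) < e" if "N \<le> i" "N \<le> j" for i j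
    proof -
      have le: "inverse (real (Suc k)) \<le> inverse (real (Suc N))" if "N \<le> k" for k
        using that by (simp add: le_imp_inverse_le)
      have "(norm (X i - X j))\<^sup>2 < e\<^sup>2"
        using par[of "X i" "X j"] X[of i] X[of j] m[of "(1/2) *\<^sub>R (X i + X j)"] N le[OF that(1)] le[OF that(2)]
        by linarith
      then show ?thesis using \<open>0 < e\<close> by (simp add: dist_norm power2_less_imp_less)
    qed
    then show "\<exists>M. \<forall>i\<ge>M. \<forall>j\<ge>M. dist (X i) (X j) < e" by blast
  qed
  then obtain z where z: "X \<longlonglongrightarrow> z" using Cauchy_convergent convergent_def by blast
  have "(\<lambda>n. J (X n)) \<longlonglongrightarrow> J z"
    unfolding J_def by (intro tendsto_intros tendsto z)
  moreover have "(\<lambda>n. m + inverse (real (Suc n))) \<longlonglongrightarrow> m + 0"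
    by (intro tendsto_intros LIMSEQ_inverse_real_of_nat)
  ultimately have "J z \<le> m + 0"
    by (rule LIMSEQ_le) (use X in \<open>auto intro: less_imp_le\<close>)
  then have min: "J z \<le> J x" for x using m[of x] by simp
  have "\<phi> h = z \<bullet> h" for h
  proof (cases "h = 0")
    case False
    define a where "a = z \<bullet> h - \<phi> h"
    have J: "J (z + t *\<^sub>R h) = J z + 2 * t * a + t\<^sup>2 * (h \<bullet> h)" for t
      unfolding J_def a_def
      by (simp add: add scaleR inner_add inner_commute power2_eq_square algebra_simps)
    \<comment> \<open>The step \<open>t = - a / (h \<bullet> h)\<close> minimizes \<open>J (z + t *\<^sub>R h)\<close> over \<open>t\<close>.\<close>
    have "0 \<le> 2 * (- a / (h \<bullet> h)) * a + (- a / (h \<bullet> h))\<^sup>2 * (h \<bullet> h)"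
      using min[of "z + (- a / (h \<bullet> h)) *\<^sub>R h"] unfolding J by simp
    also have "\<dots> = - (a\<^sup>2 / (h \<bullet> h))"
      using False by (simp add: power2_eq_square field_simps)
    finally have "a\<^sup>2 / (h \<bullet> h) \<le> 0" by simp
    moreover have "0 < h \<bullet> h" using False by simp
    ultimately have "a\<^sup>2 \<le> 0" by (simp add: divide_le_0_iff)
    then show ?thesis unfolding a_def by simp
  qed (simp add: zero)
  then show ?thesis by (rule that)
qed

text \<open>
  The adjoint is a choice of a map with the defining identity, so the identity holds as soon as some
  such map exists.  In infinite dimensions its existence is the Riesz representation theorem.
\<close>

lemma adjoint_inner:
  fixes B :: "'a::{real_inner,banach} \<Rightarrow> 'b::real_inner"
  assumes "bounded_linear B"
  shows "B x \<bullet> y = x \<bullet> adjoint B y"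
proof -
  have "\<exists>z. \<forall>x. B x \<bullet> y = x \<bullet> z" for y
  proof -
    have "bounded_linear (\<lambda>x. B x \<bullet> y)"
      using assms by (rule bounded_linear_compose[OF bounded_linear_inner_left])
    then show ?thesis by (metis Riesz_representation inner_commute)
  qed
  then obtain C where "\<forall>x y. B x \<bullet> y = x \<bullet> C y" by metis
  with adjoint_unique[OF this] show ?thesis by simp
qed

lemma bounded_linear_adjoint:
  fixes B :: "'a::{real_inner,banach} \<Rightarrow> 'b::real_inner"
  assumes B: "bounded_linear B"
  shows "bounded_linear (adjoint B)"
proof -
  obtain K where K: "\<And>x. norm (B x) \<le> norm x * K" "0 < K"
    using bounded_linear.pos_bounded[OF B] by blast
  note adj = adjoint_inner[OF B, symmetric]
  show ?thesis
  proof (rule bounded_linear_intro)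
    fix x y r
    show "adjoint B (x + y) = adjoint B x + adjoint B y"
      by (subst vector_eq_ldot[symmetric]) (simp add: adj inner_add_right)
    show "adjoint B (r *\<^sub>R x) = r *\<^sub>R adjoint B x"
      by (subst vector_eq_ldot[symmetric]) (simp add: adj)
    let ?z = "adjoint B x"
    have "norm ?z * norm ?z = B ?z \<bullet> x"
      by (simp add: adj[symmetric] power2_norm_eq_inner[symmetric] power2_eq_square)
    also have "\<dots> \<le> norm (B ?z) * norm x" by (rule norm_cauchy_schwarz)
    also have "\<dots> \<le> norm ?z * (norm x * K)"
      using mult_right_mono[OF K(1)[of ?z], of "norm x"] by (simp add: ac_simps)
    finally show "norm ?z \<le> norm x * K"
      using K(2) by (cases "?z = 0") (auto simp: mult_le_cancel_left)
  qed
qed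

section \<open>Calculus of \<open>C\<^sup>1\<close> and \<open>C\<^sup>2\<close> maps\<close>

text \<open>
  Being \<open>C\<^sup>2\<close> amounts to having a \<open>C\<^sup>1\<close> derivative.  Going through \<open>C\<^sup>1\<close> reduces the second-order
  chain, sum and inverse rules to first-order ones applied to the operator-valued derivative.
\<close>

definition C1_on :: "('a::real_normed_vector \<Rightarrow> 'b::real_normed_vector) \<Rightarrow> 'a set \<Rightarrow> bool" where
  "C1_on f U \<longleftrightarrow> open U \<and> (\<exists>f' :: 'a \<Rightarrow> 'a \<Rightarrow>\<^sub>L 'b.
     (\<forall>x\<in>U. (f has_derivative blinfun_apply (f' x)) (at x)) \<and> continuous_on U f')"

lemma C1_onI:
  assumes "open U" "\<And>x. x \<in> U \<Longrightarrow> (f has_derivative blinfun_apply (f' x)) (at x)" "continuous_on U f'"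
  shows "C1_on f U"
  unfolding C1_on_def using assms by (intro conjI exI[of _ f'] ballI)

lemma C1_onE:
  assumes "C1_on f U"
  obtains f' where "open U" "\<And>x. x \<in> U \<Longrightarrow> (f has_derivative blinfun_apply (f' x)) (at x)"
    "continuous_on U f'"
  using assms unfolding C1_on_def by (elim conjE exE) (rule that, simp_all)

lemma C2_on_iff_C1_on_derivative:
  "C2_on f U \<longleftrightarrow> (\<exists>f'. (\<forall>x\<in>U. (f has_derivative blinfun_apply (f' x)) (at x)) \<and> C1_on f' U)"
  unfolding C2_on_def C1_on_def by (intro iffI; elim conjE exE; intro conjI exI; assumption)

lemma C2_onI:
  assumes "\<And>x. x \<in> U \<Longrightarrow> (f has_derivative blinfun_apply (f' x)) (at x)" "C1_on f' U"
  shows "C2_on f U"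
  unfolding C2_on_iff_C1_on_derivative using assms by (intro conjI exI[of _ f'] ballI)

lemma C2_onE:
  assumes "C2_on f U"
  obtains f' where "\<And>x. x \<in> U \<Longrightarrow> (f has_derivative blinfun_apply (f' x)) (at x)" "C1_on f' U"
  using assms unfolding C2_on_iff_C1_on_derivative by (elim conjE exE) (rule that, simp_all)

lemma C1_on_open: "C1_on f U \<Longrightarrow> open U" by (simp add: C1_on_def)

lemma C2_on_open: "C2_on f U \<Longrightarrow> open U" by (simp add: C2_on_def)

lemma C1_on_continuous_on: "C1_on f U \<Longrightarrow> continuous_on U f"
  by (erule C1_onE) (auto intro!: continuous_at_imp_continuous_on has_derivative_continuous)

lemma C2_on_imp_C1_on: "C2_on f U \<Longrightarrow> C1_on f U"
  by (erule C2_onE) (rule C1_onI, auto intro: C1_on_continuous_on C1_on_open)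

lemma C1_on_subset: "C1_on f U \<Longrightarrow> open W \<Longrightarrow> W \<subseteq> U \<Longrightarrow> C1_on f W"
  by (erule C1_onE) (rule C1_onI, auto intro: continuous_on_subset)

lemma C2_on_subset: "C2_on f U \<Longrightarrow> open W \<Longrightarrow> W \<subseteq> U \<Longrightarrow> C2_on f W"
  by (erule C2_onE) (rule C2_onI, auto intro: C1_on_subset)

lemma C1_on_cong:
  assumes "C1_on f U" "\<And>x. x \<in> U \<Longrightarrow> f x = g x"
  shows "C1_on g U"
proof -
  obtain f' where f': "open U" "\<And>x. x \<in> U \<Longrightarrow> (f has_derivative blinfun_apply (f' x)) (at x)"
    "continuous_on U f'" using assms(1) by (elim C1_onE) (rule that, simp_all)
  have "(g has_derivative blinfun_apply (f' x)) (at x)" if "x \<in> U" for x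
    by (rule has_derivative_transform_within_open[OF f'(2)[OF that] f'(1) that assms(2)])
  with f' show ?thesis by (intro C1_onI)
qed

lemma C2_on_cong:
  assumes "C2_on f U" "\<And>x. x \<in> U \<Longrightarrow> f x = g x"
  shows "C2_on g U"
proof -
  obtain f' where f': "\<And>x. x \<in> U \<Longrightarrow> (f has_derivative blinfun_apply (f' x)) (at x)"
    "C1_on f' U" using assms(1) by (elim C2_onE) (rule that, simp_all)
  have "(g has_derivative blinfun_apply (f' x)) (at x)" if "x \<in> U" for x
    by (rule has_derivative_transform_within_open[OF f'(1)[OF that] C1_on_open[OF f'(2)] that assms(2)])
  with f' show ?thesis by (intro C2_onI)
qed

lemma blinfun_derivative_unique:
  fixes f' f'' :: "'a::real_normed_vector \<Rightarrow>\<^sub>L 'b::real_normed_vector"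
  assumes "(f has_derivative blinfun_apply f') (at x)" "(f has_derivative blinfun_apply f'') (at x)"
  shows "f' = f''"
  using has_derivative_unique[OF assms] by (simp add: blinfun_apply_inject)

text \<open>
  Derivatives at a point are unique, so the derivatives of the local pieces fit together.
\<close>

lemma C1_on_local:
  assumes U: "open U" and loc: "\<And>x. x \<in> U \<Longrightarrow> \<exists>W. x \<in> W \<and> C1_on f W"
  shows "C1_on f U"
proof -
  have "\<forall>x\<in>U. \<exists>L. (f has_derivative blinfun_apply L) (at x)"
    using loc by (blast elim: C1_onE)
  then obtain f' where f': "\<And>x. x \<in> U \<Longrightarrow> (f has_derivative blinfun_apply (f' x)) (at x)"
    by metis
  have "continuous_on U f'"
  proof (rule continuous_at_imp_continuous_on, intro ballI)
    fix x assume x: "x \<in> U"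
    obtain W where W: "x \<in> W" "C1_on f W" using loc[OF x] by blast
    obtain d where d: "open W" "\<And>x. x \<in> W \<Longrightarrow> (f has_derivative blinfun_apply (d x)) (at x)"
      "continuous_on W d" using W(2) by (elim C1_onE) (rule that, simp_all)
    have "continuous_on (W \<inter> U) f'"
      using continuous_on_subset[OF d(3), of "W \<inter> U"]
      by (rule continuous_on_eq) (auto intro: blinfun_derivative_unique[OF d(2) f'])
    then show "isCont f' x"
      using x W(1) d(1) U by (simp add: continuous_on_eq_continuous_at open_Int)
  qed
  with U f' show ?thesis by (rule C1_onI)
qed

lemma C2_on_local:
  assumes U: "open U" and loc: "\<And>x. x \<in> U \<Longrightarrow> \<exists>W. x \<in> W \<and> C2_on f W"
  shows "C2_on f U"
proof -
  have "\<forall>x\<in>U. \<exists>L. (f has_derivative blinfun_apply L) (at x)"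
    using loc by (blast elim: C2_onE)
  then obtain f' where f': "\<And>x. x \<in> U \<Longrightarrow> (f has_derivative blinfun_apply (f' x)) (at x)"
    by metis
  have "C1_on f' U"
  proof (rule C1_on_local[OF U])
    fix x assume x: "x \<in> U"
    obtain W where W: "x \<in> W" "C2_on f W" using loc[OF x] by blast
    obtain d where d: "\<And>x. x \<in> W \<Longrightarrow> (f has_derivative blinfun_apply (d x)) (at x)"
      "C1_on d W" using W(2) by (elim C2_onE) (rule that, simp_all)
    have "C1_on d (W \<inter> U)"
      using C1_on_subset[OF d(2)] U C1_on_open[OF d(2)] by (simp add: open_Int)
    then have "C1_on f' (W \<inter> U)"
      by (rule C1_on_cong) (auto intro: blinfun_derivative_unique[OF d(1) f'])
    then show "\<exists>W. x \<in> W \<and> C1_on f' W" using x W(1) by blast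
  qed
  with f' show ?thesis by (rule C2_onI)
qed

lemma C2_map_open_iff: "open U \<Longrightarrow> C2_map f U \<longleftrightarrow> C2_on f U"
proof
  assume U: "open U" and "C2_map f U"
  then show "C2_on f U"
  proof (intro C2_on_local)
    fix x assume x: "x \<in> U"
    then obtain W g where W: "x \<in> W" "C2_on g W" "\<forall>y\<in>U \<inter> W. g y = f y"
      using \<open>C2_map f U\<close> unfolding C2_map_def by blast
    have "C2_on g (U \<inter> W)" using C2_on_subset[OF W(2)] U C2_on_open[OF W(2)] by (simp add: open_Int)
    then have "C2_on f (U \<inter> W)" by (rule C2_on_cong) (use W(3) in auto)
    then show "\<exists>W. x \<in> W \<and> C2_on f W" using x W(1) by blast
  qed
next
  assume "open U" "C2_on f U"
  then show "C2_map f U" unfolding C2_map_def by blast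
qed

lemma C2_map_subset:
  assumes "C2_map f U" "S \<subseteq> U"
  shows "C2_map f S"
  unfolding C2_map_def
proof
  fix x assume "x \<in> S"
  then obtain W g where "x \<in> W" "C2_on g W" "\<forall>y\<in>U \<inter> W. g y = f y"
    using assms unfolding C2_map_def by (meson subsetD)
  then show "\<exists>W g. x \<in> W \<and> C2_on g W \<and> (\<forall>y\<in>S \<inter> W. g y = f y)"
    using assms(2) by (intro exI[of _ W] exI[of _ g]) auto
qed

lemma C1_on_add:
  assumes "C1_on f U" "C1_on g U" shows "C1_on (\<lambda>x. f x + g x) U"
proof -
  obtain f' where f': "open U" "\<And>x. x \<in> U \<Longrightarrow> (f has_derivative blinfun_apply (f' x)) (at x)"
    "continuous_on U f'" using assms(1) by (elim C1_onE) (rule that, simp_all)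
  obtain g' where g': "\<And>x. x \<in> U \<Longrightarrow> (g has_derivative blinfun_apply (g' x)) (at x)"
    "continuous_on U g'" using assms(2) by (elim C1_onE) (rule that, simp_all)
  show ?thesis
    by (rule C1_onI[where f' = "\<lambda>x. f' x + g' x"])
      (use f' g' in \<open>auto intro!: continuous_intros derivative_eq_intros simp: plus_blinfun.rep_eq\<close>)
qed

lemma C2_on_add:
  assumes "C2_on f U" "C2_on g U" shows "C2_on (\<lambda>x. f x + g x) U"
proof -
  obtain f' where f': "\<And>x. x \<in> U \<Longrightarrow> (f has_derivative blinfun_apply (f' x)) (at x)"
    "C1_on f' U" using assms(1) by (elim C2_onE) (rule that, simp_all)
  obtain g' where g': "\<And>x. x \<in> U \<Longrightarrow> (g has_derivative blinfun_apply (g' x)) (at x)"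
    "C1_on g' U" using assms(2) by (elim C2_onE) (rule that, simp_all)
  show ?thesis
    by (rule C2_onI[where f' = "\<lambda>x. f' x + g' x"])
      (use f' g' in \<open>auto intro!: C1_on_add derivative_eq_intros simp: plus_blinfun.rep_eq\<close>)
qed

lemma C2_on_affine:
  assumes "bounded_linear L"
  shows "C2_on (\<lambda>x. L x + a) UNIV"
proof (rule C2_onI[where f' = "\<lambda>_. Blinfun L"])
  show "((\<lambda>x. L x + a) has_derivative blinfun_apply (Blinfun L)) (at x)" for x
    using assms by (auto intro!: derivative_eq_intros bounded_linear_imp_has_derivative
        simp: bounded_linear_Blinfun_apply)
  show "C1_on (\<lambda>_::'a. Blinfun L) UNIV"
    by (rule C1_onI[where f' = "\<lambda>_. 0"])
       (auto simp: zero_blinfun.rep_eq[abs_def])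
qed

lemma C1_on_bilinear:
  assumes "bounded_bilinear p" "C1_on f U" "C1_on g U"
  shows "C1_on (\<lambda>x. p (f x) (g x)) U"
proof -
  interpret bounded_bilinear p by fact
  obtain f' where f': "open U" "\<And>x. x \<in> U \<Longrightarrow> (f has_derivative blinfun_apply (f' x)) (at x)"
    "continuous_on U f'" using assms(2) by (elim C1_onE) (rule that, simp_all)
  obtain g' where g': "\<And>x. x \<in> U \<Longrightarrow> (g has_derivative blinfun_apply (g' x)) (at x)"
    "continuous_on U g'" using assms(3) by (elim C1_onE) (rule that, simp_all)
  show ?thesis
  proof (rule C1_onI[where f' = "\<lambda>x. (prod_right (f x) o\<^sub>L g' x) + (prod_left (g x) o\<^sub>L f' x)"])
    show "open U" by fact
    show "((\<lambda>x. p (f x) (g x)) has_derivative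
        blinfun_apply ((prod_right (f x) o\<^sub>L g' x) + (prod_left (g x) o\<^sub>L f' x))) (at x)"
      if "x \<in> U" for x
      using FDERIV[OF f'(2)[OF that] g'(1)[OF that]]
      by (rule has_derivative_eq_rhs) (auto simp: plus_blinfun.rep_eq)
    show "continuous_on U (\<lambda>x. (prod_right (f x) o\<^sub>L g' x) + (prod_left (g x) o\<^sub>L f' x))"
      by (intro continuous_intros bounded_linear.continuous_on[OF bounded_linear_prod_right]
          bounded_linear.continuous_on[OF bounded_linear_prod_left]
          bounded_bilinear.continuous_on[OF bounded_bilinear_blinfun_compose]
          C1_on_continuous_on[OF assms(2)] C1_on_continuous_on[OF assms(3)] f' g')
  qed
qed

lemma C1_on_compose:
  assumes "C1_on f U" "C1_on g V" "f ` U \<subseteq> V"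
  shows "C1_on (\<lambda>x. g (f x)) U"
proof -
  obtain f' where f': "open U" "\<And>x. x \<in> U \<Longrightarrow> (f has_derivative blinfun_apply (f' x)) (at x)"
    "continuous_on U f'" using assms(1) by (elim C1_onE) (rule that, simp_all)
  obtain g' where g': "\<And>x. x \<in> V \<Longrightarrow> (g has_derivative blinfun_apply (g' x)) (at x)"
    "continuous_on V g'" using assms(2) by (elim C1_onE) (rule that, simp_all)
  show ?thesis
  proof (rule C1_onI[where f' = "\<lambda>x. g' (f x) o\<^sub>L f' x"])
    show "open U" by fact
    show "((\<lambda>x. g (f x)) has_derivative blinfun_apply (g' (f x) o\<^sub>L f' x)) (at x)"
      if "x \<in> U" for x
      using has_derivative_compose[OF f'(2)[OF that] g'(1)[of "f x"]] that assms(3)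
      by (auto simp: blinfun_compose.rep_eq o_def)
    show "continuous_on U (\<lambda>x. g' (f x) o\<^sub>L f' x)"
      by (intro bounded_bilinear.continuous_on[OF bounded_bilinear_blinfun_compose] f'
         continuous_on_compose2[OF g'(2) C1_on_continuous_on[OF assms(1)]] assms(3))
  qed
qed

lemma C2_on_compose:
  assumes "C2_on f U" "C2_on g V" "f ` U \<subseteq> V"
  shows "C2_on (\<lambda>x. g (f x)) U"
proof -
  obtain f' where f': "\<And>x. x \<in> U \<Longrightarrow> (f has_derivative blinfun_apply (f' x)) (at x)"
    "C1_on f' U" using assms(1) by (elim C2_onE) (rule that, simp_all)
  obtain g' where g': "\<And>x. x \<in> V \<Longrightarrow> (g has_derivative blinfun_apply (g' x)) (at x)"
    "C1_on g' V" using assms(2) by (elim C2_onE) (rule that, simp_all)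
  show ?thesis
  proof (rule C2_onI[where f' = "\<lambda>x. g' (f x) o\<^sub>L f' x"])
    show "((\<lambda>x. g (f x)) has_derivative blinfun_apply (g' (f x) o\<^sub>L f' x)) (at x)"
      if "x \<in> U" for x
      using has_derivative_compose[OF f'(1)[OF that] g'(1)[of "f x"]] that assms(3)
      by (auto simp: blinfun_compose.rep_eq o_def)
    show "C1_on (\<lambda>x. g' (f x) o\<^sub>L f' x) U"
      by (intro C1_on_bilinear[OF bounded_bilinear_blinfun_compose] f'
         C1_on_compose[OF C2_on_imp_C1_on[OF assms(1)] g'(2)] assms(3))
  qed
qed

section \<open>The inverse function theorem in Banach spaces\<close>

text \<open>
  A product rule in which the first factor is merely continuous, at a zero of the second factor.  For
  the inverse \<open>J\<close> of a differentiable operator family \<open>X\<close> it applies to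
  \<open>J y - J x = J y o\<^sub>L ((X x - X y) o\<^sub>L J x)\<close>, where differentiability of \<open>J\<close> is not yet known.
\<close>

lemma bilinear_has_derivative_vanishing:
  fixes p :: "'b::real_normed_vector \<Rightarrow> 'c::real_normed_vector \<Rightarrow> 'd::real_normed_vector"
  assumes p: "bounded_bilinear p" and a: "isCont a x"
    and b: "(b has_derivative b') (at x)" "b x = 0"
  shows "((\<lambda>y. p (a y) (b y)) has_derivative (\<lambda>h. p (a x) (b' h))) (at x)"
proof -
  interpret bounded_bilinear p by fact
  obtain K where K: "0 < K" "\<And>u v. norm (p u v) \<le> norm u * norm v * K"
    using pos_bounded by blast
  obtain L where L: "\<And>h. norm (b' h) \<le> norm h * L"
    using bounded_linear.bounded[OF has_derivative_bounded_linear[OF b(1)]] by blast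
  let ?q = "\<lambda>y. norm (b y - b x - b' (y - x)) / norm (y - x)"
  have q: "(?q \<longlongrightarrow> 0) (at x)"
    using b(1) by (simp add: has_derivative_iff_norm)
  have "((\<lambda>y. norm (a y - a x) * (?q y + L) * K) \<longlongrightarrow> norm (a x - a x) * (0 + L) * K) (at x)"
    by (intro tendsto_intros q) (use a in \<open>simp add: isCont_def\<close>)
  then have lim: "((\<lambda>y. norm (a y - a x) * (?q y + L) * K) \<longlongrightarrow> 0) (at x)" by simp
  have bound: "norm (p (a y - a x) (b y)) / norm (y - x) \<le> norm (a y - a x) * (?q y + L) * K"
    if "y \<noteq> x" for y
  proof -
    have pos: "0 < norm (y - x)" using that by simp
    have "norm (b y) \<le> norm (b y - b' (y - x)) + norm (b' (y - x))"
      by (metis diff_add_cancel norm_triangle_ineq)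
    also have "\<dots> \<le> (?q y + L) * norm (y - x)"
      using L[of "y - x"] pos b(2) by (simp add: field_simps)
    finally have bnd: "norm (b y) \<le> (?q y + L) * norm (y - x)" .
    have "norm (p (a y - a x) (b y)) \<le> norm (a y - a x) * norm (b y) * K" by (rule K(2))
    also have "\<dots> \<le> norm (a y - a x) * ((?q y + L) * norm (y - x)) * K"
      by (intro mult_right_mono mult_left_mono bnd) (use K in auto)
    also have "\<dots> = norm (a y - a x) * (?q y + L) * K * norm (y - x)"
      by (simp only: ac_simps)
    finally show ?thesis using pos by (simp only: pos_divide_le_eq)
  qed
  have "((\<lambda>y. norm (p (a y - a x) (b y)) / norm (y - x)) \<longlongrightarrow> 0) (at x)"
  proof (rule Lim_null_comparison[OF _ lim])
    show "\<forall>\<^sub>F y in at x. norm (norm (p (a y - a x) (b y)) / norm (y - x))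
        \<le> norm (a y - a x) * (?q y + L) * K"
      unfolding eventually_at_topological using bound by (intro exI[of _ UNIV]) auto
  qed
  then have "((\<lambda>y. p (a y - a x) (b y)) has_derivative (\<lambda>h. 0)) (at x)"
    by (simp add: has_derivative_iff_norm zero_left)
  moreover have "((\<lambda>y. p (a x) (b y)) has_derivative (\<lambda>h. p (a x) (b' h))) (at x)"
    by (rule bounded_linear.has_derivative[OF bounded_linear_right b(1)])
  ultimately have "((\<lambda>y. p (a y - a x) (b y) + p (a x) (b y)) has_derivative (\<lambda>h. 0 + p (a x) (b' h))) (at x)"
    by (rule has_derivative_add)
  then show ?thesis by (simp add: diff_left)
qed

lemma blinfun_inverse_difference:
  assumes "J' o\<^sub>L X' = id_blinfun" "X o\<^sub>L J = id_blinfun"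
  shows "J' - J = (J' o\<^sub>L (X - X')) o\<^sub>L J"
proof (rule blinfun_eqI)
  fix v
  have "J' (X' w) = w" "X (J v) = v" for w
    using assms by (metis blinfun_apply_blinfun_compose blinfun_apply_id_blinfun)+
  then show "(J' - J) v = ((J' o\<^sub>L (X - X')) o\<^sub>L J) v"
    by (simp add: blinfun.bilinear_simps)
qed

text \<open>
  The identity for \<open>J y - J x\<close> bounds it by \<open>norm (J y)\<close> times a small factor.  This first shows that
  \<open>norm (J y)\<close> is at most \<open>2 * norm (J x)\<close> near \<open>x\<close>, and then that the difference tends to zero.
\<close>

lemma isCont_blinfun_inverse:
  assumes U: "open U" "x \<in> U" and X: "isCont X x"
    and inv: "\<And>y. y \<in> U \<Longrightarrow> J y o\<^sub>L X y = id_blinfun" "\<And>y. y \<in> U \<Longrightarrow> X y o\<^sub>L J y = id_blinfun"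
  shows "isCont J x"
proof -
  let ?e = "\<lambda>y. norm (X x - X y) * norm (J x)"
  have "(?e \<longlongrightarrow> norm (X x - X x) * norm (J x)) (at x)"
    by (intro tendsto_intros) (use X in \<open>simp add: isCont_def\<close>)
  then have e: "(?e \<longlongrightarrow> 0) (at x)" by simp
  have small: "\<forall>\<^sub>F y in at x. ?e y < 1/2"
    by (rule order_tendstoD(2)[OF e]) simp
  have inU: "\<forall>\<^sub>F y in at x. y \<in> U"
    using U eventually_at_topological by blast
  have bound: "\<forall>\<^sub>F y in at x. norm (J y - J x) \<le> 2 * norm (J x) * ?e y"
    using small inU
  proof eventually_elim
    case (elim y)
    have le: "norm (J y - J x) \<le> norm (J y) * ?e y"
    proof -
      have "J y - J x = (J y o\<^sub>L (X x - X y)) o\<^sub>L J x"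
        by (rule blinfun_inverse_difference) (use inv elim U in auto)
      also have "norm \<dots> \<le> norm (J y o\<^sub>L (X x - X y)) * norm (J x)" by (rule norm_blinfun_compose)
      also have "\<dots> \<le> norm (J y) * norm (X x - X y) * norm (J x)"
        by (intro mult_right_mono norm_blinfun_compose) simp
      finally show ?thesis by (simp add: mult.assoc)
    qed
    have "norm (J y) * ?e y \<le> norm (J y) * (1/2)"
      by (rule mult_left_mono) (use elim in auto)
    moreover have "norm (J y) \<le> norm (J x) + norm (J y - J x)"
      by (metis add.commute diff_add_cancel norm_triangle_ineq)
    ultimately have "norm (J y) \<le> 2 * norm (J x)" using le by linarith
    then have "norm (J y) * ?e y \<le> 2 * norm (J x) * ?e y"
      by (rule mult_right_mono) simp
    with le show ?case by linarith
  qed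
  have "((\<lambda>y. 2 * norm (J x) * ?e y) \<longlongrightarrow> 2 * norm (J x) * 0) (at x)"
    by (intro tendsto_intros e)
  then have "((\<lambda>y. J y - J x) \<longlongrightarrow> 0) (at x)"
    by (intro Lim_null_comparison[OF bound]) simp
  then show ?thesis unfolding isCont_def by (simp add: LIM_zero_iff)
qed

lemma C1_on_blinfun_inverse:
  assumes X: "C1_on X U"
    and inv: "\<And>y. y \<in> U \<Longrightarrow> J y o\<^sub>L X y = id_blinfun" "\<And>y. y \<in> U \<Longrightarrow> X y o\<^sub>L J y = id_blinfun"
  shows "C1_on J U"
proof -
  obtain X' where X': "open U" "\<And>x. x \<in> U \<Longrightarrow> (X has_derivative blinfun_apply (X' x)) (at x)"
    "continuous_on U X'" using X by (elim C1_onE) (rule that, simp_all)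
  let ?pr = "bounded_bilinear.prod_right (o\<^sub>L)" and ?pl = "bounded_bilinear.prod_left (o\<^sub>L)"
  note comp = bounded_bilinear_blinfun_compose
  have cont: "isCont J x" if "x \<in> U" for x
    by (rule isCont_blinfun_inverse[OF X'(1) that has_derivative_continuous[OF X'(2)[OF that]] inv])
  show ?thesis
  proof (rule C1_onI[where f' = "\<lambda>x. - (?pr (J x) o\<^sub>L (?pl (J x) o\<^sub>L X' x))"])
    show "open U" by fact
    show "continuous_on U (\<lambda>x. - (?pr (J x) o\<^sub>L (?pl (J x) o\<^sub>L X' x)))"
      by (intro continuous_intros bounded_bilinear.continuous_on[OF comp] X'(3)
          bounded_linear.continuous_on[OF bounded_bilinear.bounded_linear_prod_right[OF comp]]
          bounded_linear.continuous_on[OF bounded_bilinear.bounded_linear_prod_left[OF comp]]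
          continuous_at_imp_continuous_on ballI cont)
    fix x assume x: "x \<in> U"
    have "((\<lambda>y. (X x - X y) o\<^sub>L J x) has_derivative (\<lambda>h. (0 - X' x h) o\<^sub>L J x)) (at x)"
      by (intro bounded_linear.has_derivative[OF bounded_bilinear.bounded_linear_left[OF comp]]
           has_derivative_diff has_derivative_const X'(2) x)
    from bilinear_has_derivative_vanishing[OF comp cont[OF x] this]
    have "((\<lambda>y. J y o\<^sub>L ((X x - X y) o\<^sub>L J x)) has_derivative (\<lambda>h. J x o\<^sub>L ((0 - X' x h) o\<^sub>L J x))) (at x)"
      by simp
    then have "((\<lambda>y. J x + (J y o\<^sub>L ((X x - X y) o\<^sub>L J x))) has_derivative
        (\<lambda>h. 0 + (J x o\<^sub>L ((0 - X' x h) o\<^sub>L J x)))) (at x)"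
      by (intro has_derivative_add has_derivative_const)
    then have "((\<lambda>y. J x + (J y o\<^sub>L ((X x - X y) o\<^sub>L J x))) has_derivative
        (- (?pr (J x) o\<^sub>L (?pl (J x) o\<^sub>L X' x)))) (at x)"
      by (rule has_derivative_eq_rhs)
        (auto simp: fun_eq_iff uminus_blinfun.rep_eq bounded_bilinear.prod_right.rep_eq[OF comp]
          bounded_bilinear.prod_left.rep_eq[OF comp] blinfun.bilinear_simps intro!: blinfun_eqI)
    then show "(J has_derivative (- (?pr (J x) o\<^sub>L (?pl (J x) o\<^sub>L X' x)))) (at x)"
    proof (rule has_derivative_transform_within_open[OF _ X'(1) x])
      fix y assume "y \<in> U"
      then have "J y - J x = (J y o\<^sub>L (X x - X y)) o\<^sub>L J x"
        by (intro blinfun_inverse_difference inv x)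
      also have "\<dots> = J y o\<^sub>L ((X x - X y) o\<^sub>L J x)" by (rule blinfun_eqI) simp
      finally show "J x + (J y o\<^sub>L ((X x - X y) o\<^sub>L J x)) = J y"
        by (metis add.commute diff_add_cancel)
    qed
  qed
qed

text \<open>
  The Banach fixed point theorem for \<open>y \<longmapsto> z + N y\<close>.  The ball has twice the radius that \<open>z\<close> may be away
  from the value at the centre, which is what a contraction constant of one half costs.  It serves
  both the nonlinear problem and the inversion of linear operators near the identity.
\<close>

lemma contraction_perturbation_solvable:
  fixes N :: "'a::banach \<Rightarrow> 'a"
  assumes lip: "\<And>u v. u \<in> cball a s \<Longrightarrow> v \<in> cball a s \<Longrightarrow> norm (N u - N v) \<le> (1/2) * norm (u - v)"
    and z: "norm (z - (a - N a)) \<le> s / 2"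
  shows "\<exists>y\<in>cball a s. y - N y = z"
proof -
  have s: "0 \<le> s" using z norm_ge_zero[of "z - (a - N a)"] by linarith
  have "\<exists>!y\<in>cball a s. z + N y = y"
  proof (rule Banach_fix[where c = "1/2"])
    show "complete (cball a s)" by (simp add: complete_eq_closed)
    show "(\<lambda>y. z + N y) ` cball a s \<subseteq> cball a s"
    proof (rule image_subsetI)
      fix y assume y: "y \<in> cball a s"
      have "norm (z + N y - a) \<le> norm (z - (a - N a)) + norm (N y - N a)"
        using norm_triangle_ineq[of "z - (a - N a)" "N y - N a"] by (simp add: algebra_simps)
      also have "\<dots> \<le> s / 2 + (1/2) * norm (y - a)"
        by (intro add_mono z lip y) (use s in auto)
      also have "\<dots> \<le> s" using y by (simp add: dist_norm norm_minus_commute)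
      finally show "z + N y \<in> cball a s" by (simp add: dist_norm norm_minus_commute)
    qed
  qed (use s lip in \<open>auto simp: dist_norm\<close>)
  then show ?thesis by (metis add_diff_cancel_right')
qed

lemma norm_le_of_half_contraction:
  fixes u v :: "'a::real_normed_vector"
  assumes "norm v \<le> (1/2) * norm u"
  shows "norm u \<le> 2 * norm (u - v)"
  using assms norm_triangle_ineq[of "u - v" v] by simp

lemma blinfun_near_id_invertible:
  fixes T :: "'a::banach \<Rightarrow>\<^sub>L 'a"
  assumes T: "norm (id_blinfun - T) \<le> 1/2"
  obtains J where "J o\<^sub>L T = id_blinfun" "T o\<^sub>L J = id_blinfun"
proof -
  have half: "norm (v - T v) \<le> (1/2) * norm v" for v
    using norm_blinfun[of "id_blinfun - T" v] mult_right_mono[OF T, of "norm v"]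
    by (simp add: blinfun.bilinear_simps)
  have low: "norm v \<le> 2 * norm (T v)" for v
    using norm_le_of_half_contraction[OF half[of v]] by simp
  have inj: "inj T"
  proof (rule injI)
    fix u v assume "T u = T v"
    then show "u = v" using low[of "u - v"] by (simp add: blinfun.diff_right)
  qed
  have surj: "surj T"
    unfolding surj_def
  proof
    fix z
    have "\<exists>y\<in>cball 0 (2 * norm z). y - (y - T y) = z"
    proof (rule contraction_perturbation_solvable)
      show "norm (u - T u - (v - T v)) \<le> (1/2) * norm (u - v)" for u v
        using half[of "u - v"] by (simp add: blinfun.bilinear_simps algebra_simps)
    qed (simp add: blinfun.zero_right)
    then show "\<exists>y. z = T y" by auto
  qed
  define j where "j = inv T"
  have Tj: "T (j z) = z" for z unfolding j_def using surj by (rule surj_f_inv_f)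
  have jT: "j (T v) = v" for v unfolding j_def using inj by simp
  have "bounded_linear j"
  proof (rule bounded_linear_intro)
    show "j (u + v) = j u + j v" for u v
      by (metis Tj jT blinfun.add_right)
    show "j (r *\<^sub>R u) = r *\<^sub>R j u" for r u
      by (metis Tj jT blinfun.scaleR_right)
    show "norm (j u) \<le> norm u * 2" for u
      using low[of "j u"] by (simp add: Tj)
  qed
  then have "blinfun_apply (Blinfun j) = j" by (rule bounded_linear_Blinfun_apply)
  then have "Blinfun j o\<^sub>L T = id_blinfun" "T o\<^sub>L Blinfun j = id_blinfun"
    by (auto intro!: blinfun_eqI simp: Tj jT)
  then show ?thesis by (rule that)
qed

text \<open>
  Normalizing the derivative to the identity makes \<open>\<psi>\<close> a perturbation of the identity by a half
  contraction on a small ball, which gives a Lipschitz local inverse \<open>\<theta>\<close>.  Its derivative at \<open>z\<close> is the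
  operator inverse of the derivative of \<open>\<psi>\<close> at \<open>\<theta> z\<close>; this formula raises the regularity of \<open>\<theta>\<close> from
  continuous to \<open>C\<^sup>1\<close> and then to \<open>C\<^sup>2\<close>.
\<close>

theorem C2_inverse_function:
  fixes \<psi> :: "'a::banach \<Rightarrow> 'a"
  assumes \<psi>: "C2_on \<psi> V" and a: "a \<in> V" and da: "(\<psi> has_derivative (\<lambda>h. h)) (at a)"
  shows "\<exists>V0 W \<theta>. a \<in> V0 \<and> V0 \<subseteq> V \<and> C2_on \<psi> V0 \<and> C2_on \<theta> W \<and> \<psi> ` V0 = W \<and> \<theta> ` W = V0 \<and>
    (\<forall>y\<in>V0. \<theta> (\<psi> y) = y) \<and> (\<forall>z\<in>W. \<psi> (\<theta> z) = z)"
proof -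
  obtain d where d: "\<And>x. x \<in> V \<Longrightarrow> (\<psi> has_derivative blinfun_apply (d x)) (at x)"
    and dC1: "C1_on d V" using \<psi> by (elim C2_onE) (rule that, simp_all)
  have V: "open V" using \<psi> by (rule C2_on_open)
  have "d a = id_blinfun"
    by (rule blinfun_derivative_unique[OF d[OF a]]) (use da in \<open>simp add: id_blinfun.rep_eq\<close>)
  moreover have "isCont d a"
    using C1_on_continuous_on[OF dC1] V a continuous_on_eq_continuous_at by blast
  ultimately have "(d \<longlongrightarrow> id_blinfun) (nhds a)"
    by (metis isCont_def tendsto_at_iff_tendsto_nhds)
  then have "\<forall>\<^sub>F x in nhds a. dist (d x) id_blinfun < 1/2 \<and> x \<in> V"
    by (intro eventually_conj tendstoD eventually_nhds_in_open V a) simp_all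
  then obtain r where r: "0 < r" "\<And>x. x \<in> ball a r \<Longrightarrow> dist (d x) id_blinfun < 1/2 \<and> x \<in> V"
    unfolding eventually_nhds_metric by (auto simp: dist_commute)
  have near: "norm (id_blinfun - d x) \<le> 1/2" and inV: "x \<in> V" if "x \<in> ball a r" for x
    using r(2)[OF that] by (auto simp: dist_norm norm_minus_commute)
  define N where "N x = x - \<psi> x" for x
  have lip: "norm (N u - N v) \<le> (1/2) * norm (u - v)" if "u \<in> ball a r" "v \<in> ball a r" for u v
  proof (rule differentiable_bound[where f' = "\<lambda>x. blinfun_apply (id_blinfun - d x)" and S = "ball a r"])
    show "(N has_derivative blinfun_apply (id_blinfun - d x)) (at x within ball a r)"
      if "x \<in> ball a r" for x
    proof -
      have "(N has_derivative (\<lambda>h. h - d x h)) (at x within ball a r)"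
        unfolding N_def
        by (intro has_derivative_diff has_derivative_ident has_derivative_at_withinI[OF d[OF inV[OF that]]])
      then show ?thesis by (simp add: minus_blinfun.rep_eq id_blinfun.rep_eq)
    qed
    show "onorm (blinfun_apply (id_blinfun - d x)) \<le> 1/2" if "x \<in> ball a r" for x
      using near[OF that] by (simp add: norm_blinfun.rep_eq)
  qed (use that in auto)
  have expand: "norm (u - v) \<le> 2 * norm (\<psi> u - \<psi> v)" if "u \<in> ball a r" "v \<in> ball a r" for u v
    using norm_le_of_half_contraction[OF lip[OF that]] by (simp add: N_def)
  \<comment> \<open>Values within \<open>r/4\<close> are attained in the closed ball of radius \<open>r/2\<close>, inside the open ball of radius \<open>r\<close>.\<close>
  define W where "W = ball (\<psi> a) (r/4)"
  define V0 where "V0 = ball a r \<inter> \<psi> -` W"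
  have cont: "continuous_on (ball a r) \<psi>"
    using C1_on_continuous_on[OF C2_on_imp_C1_on[OF \<psi>]] inV by (meson continuous_on_subset subsetI)
  have oV0: "open V0" unfolding V0_def W_def Int_commute[of "ball a r"]
    by (rule continuous_on_open_vimage[THEN iffD1, rule_format, OF _ cont]) auto
  have ex: "\<exists>y. y \<in> V0 \<and> \<psi> y = z" if z: "z \<in> W" for z
  proof -
    have "\<exists>y\<in>cball a (r/2). y - N y = z"
    proof (rule contraction_perturbation_solvable)
      show "norm (N u - N v) \<le> (1/2) * norm (u - v)" if "u \<in> cball a (r/2)" "v \<in> cball a (r/2)" for u v
        by (rule lip) (use that r(1) in auto)
      show "norm (z - (a - N a)) \<le> (r/2) / 2"
        using z by (simp add: N_def W_def dist_norm norm_minus_commute)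
    qed
    then obtain y where y: "y \<in> cball a (r/2)" "\<psi> y = z" by (auto simp: N_def)
    then have "y \<in> ball a r" using r(1) by auto
    with y z show ?thesis unfolding V0_def by auto
  qed
  define \<theta> where "\<theta> z = (SOME y. y \<in> V0 \<and> \<psi> y = z)" for z
  have \<theta>: "\<theta> z \<in> V0" "\<psi> (\<theta> z) = z" if "z \<in> W" for z
    using someI_ex[OF ex[OF that]] unfolding \<theta>_def by auto
  have \<psi>W: "\<psi> y \<in> W" "y \<in> ball a r" if "y \<in> V0" for y using that by (auto simp: V0_def)
  have \<theta>\<psi>: "\<theta> (\<psi> y) = y" if "y \<in> V0" for y
    using expand[of "\<theta> (\<psi> y)" y] \<theta>[OF \<psi>W(1)[OF that]] \<psi>W(2) that by simp
  have oW: "open W" by (simp add: W_def)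
  have "\<exists>J. \<forall>y\<in>V0. J y o\<^sub>L d y = id_blinfun \<and> d y o\<^sub>L J y = id_blinfun"
    by (intro bchoice ballI) (metis blinfun_near_id_invertible near \<psi>W(2))
  then obtain J where J: "\<And>y. y \<in> V0 \<Longrightarrow> J y o\<^sub>L d y = id_blinfun" "\<And>y. y \<in> V0 \<Longrightarrow> d y o\<^sub>L J y = id_blinfun"
    by blast
  have lip\<theta>: "2-lipschitz_on W \<theta>"
  proof (rule lipschitz_onI)
    fix u v assume "u \<in> W" "v \<in> W"
    then show "dist (\<theta> u) (\<theta> v) \<le> 2 * dist u v"
      using expand[of "\<theta> u" "\<theta> v"] \<theta> \<psi>W(2) by (simp add: dist_norm)
  qed simp
  have cont\<theta>: "continuous_on W \<theta>" by (rule lipschitz_on_continuous_on[OF lip\<theta>])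
  have d\<theta>: "(\<theta> has_derivative J (\<theta> z)) (at z)" if z: "z \<in> W" for z
  proof (rule has_derivative_inverse_basic)
    show "(\<psi> has_derivative d (\<theta> z)) (at (\<theta> z))" using d inV \<psi>W(2) \<theta>(1) z by blast
    show "blinfun_apply (J (\<theta> z)) \<circ> blinfun_apply (d (\<theta> z)) = id"
      by (simp add: J(1)[OF \<theta>(1)[OF z]] fun_eq_iff flip: blinfun_apply_blinfun_compose)
    show "continuous (at z) \<theta>" using cont\<theta> oW z continuous_on_eq_continuous_at by blast
  qed (use oW z \<theta> in \<open>auto simp: blinfun.bounded_linear_right\<close>)
  have inW: "\<theta> ` W \<subseteq> V" using \<theta> \<psi>W(2) inV by blast
  have contJ: "continuous_on W (\<lambda>z. J (\<theta> z))"
  proof (rule continuous_at_imp_continuous_on, intro ballI)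
    fix z assume z: "z \<in> W"
    have "continuous_on W (\<lambda>z. d (\<theta> z))"
      by (rule continuous_on_compose2[OF C1_on_continuous_on[OF dC1] cont\<theta> inW])
    then have "isCont (\<lambda>z. d (\<theta> z)) z" using oW z continuous_on_eq_continuous_at by blast
    then show "isCont (\<lambda>z. J (\<theta> z)) z"
      by (rule isCont_blinfun_inverse[OF oW z]) (use J \<theta> in auto)
  qed
  have C1\<theta>: "C1_on \<theta> W" using oW d\<theta> contJ by (rule C1_onI)
  have C1J: "C1_on (\<lambda>z. J (\<theta> z)) W"
    by (rule C1_on_blinfun_inverse[OF C1_on_compose[OF C1\<theta> dC1 inW]]) (use J \<theta> in auto)
  have "C2_on \<theta> W" using d\<theta> C1J by (rule C2_onI)
  moreover have "V0 \<subseteq> V" using \<psi>W(2) inV by blast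
  moreover have "C2_on \<psi> V0" using C2_on_subset[OF \<psi> oV0] calculation(2) .
  moreover have "a \<in> V0" using r(1) by (simp add: V0_def W_def)
  moreover have "\<psi> ` V0 = W" using \<psi>W(1) \<theta> by (metis image_subsetI subset_antisym imageI subsetI)
  moreover have "\<theta> ` W = V0" using \<psi>W(1) \<theta> \<theta>\<psi> by (metis image_subsetI subset_antisym imageI subsetI)
  ultimately show ?thesis using \<theta>(2) \<theta>\<psi>
    by - (rule exI[of _ V0], rule exI[of _ W], rule exI[of _ \<theta>], simp)
qed

section \<open>Slice charts and tangent spaces\<close>

text \<open>
  Membership in \<open>M\<close> is tested pointwise, rather than by \<open>h ` (M \<inter> U) = F \<inter> V\<close>.  For a bijection \<open>h\<close>
  from \<open>U\<close> to \<open>V\<close> the two are equivalent, and the pointwise form passes directly to compositions of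
  \<open>h\<close> with a map that preserves \<open>F\<close>.
\<close>

definition slice_chart ::
  "'a::real_normed_vector set \<Rightarrow> 'a set \<Rightarrow> 'a set \<Rightarrow> 'a set \<Rightarrow> ('a \<Rightarrow> 'a) \<Rightarrow> ('a \<Rightarrow> 'a) \<Rightarrow> bool" where
  "slice_chart M F U V h k \<longleftrightarrow>
     C2_on h U \<and> C2_on k V \<and> h ` U = V \<and> k ` V = U \<and>
     (\<forall>x\<in>U. k (h x) = x) \<and> (\<forall>y\<in>V. h (k y) = y) \<and>
     subspace F \<and> closed F \<and> (\<forall>x\<in>U. h x \<in> F \<longleftrightarrow> x \<in> M)"

lemma slice_chart_image:
  assumes "slice_chart M F U V h k"
  shows "h ` (M \<inter> U) = F \<inter> V"
proof -
  have h: "h ` U = V" and m: "\<And>x. x \<in> U \<Longrightarrow> h x \<in> F \<longleftrightarrow> x \<in> M"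
    using assms unfolding slice_chart_def by auto
  show ?thesis
  proof
    show "h ` (M \<inter> U) \<subseteq> F \<inter> V" using h m by auto
    show "F \<inter> V \<subseteq> h ` (M \<inter> U)" using h m by auto
  qed
qed

lemma slice_chart_diffeomorphism:
  assumes "slice_chart M F U V h k"
  shows "C2_diffeomorphism U V h k"
  using assms unfolding slice_chart_def C2_diffeomorphism_def
  by (meson C2_map_open_iff C2_on_open)

lemma embedded_submanifold_slice_chart:
  assumes "C2_embedded_submanifold M" "x \<in> M"
  obtains U V f g F where "slice_chart M F U V f g" "x \<in> U"
proof -
  obtain U V :: "'a set" and f g F where
    c: "open U" "x \<in> U" "open V" "C2_diffeomorphism U V f g" "subspace F" "closed F"
    "f ` (M \<inter> U) = F \<inter> V"
    using assms unfolding C2_embedded_submanifold_def by (elim ballE exE conjE) auto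
  have d: "f ` U = V" "g ` V = U" "\<And>x. x \<in> U \<Longrightarrow> g (f x) = x" "\<And>y. y \<in> V \<Longrightarrow> f (g y) = y"
    "C2_on f U" "C2_on g V"
    using c(1,3,4) C2_map_open_iff unfolding C2_diffeomorphism_def by auto
  have "f x \<in> F \<longleftrightarrow> x \<in> M" if "x \<in> U" for x
  proof
    assume "f x \<in> F"
    then have "f x \<in> f ` (M \<inter> U)" using c(7) d(1) that by auto
    then obtain m where "m \<in> M" "m \<in> U" "f x = f m" by auto
    then show "x \<in> M" using d(3) that by metis
  qed (use c(7) that in auto)
  then have "slice_chart M F U V f g" using c d unfolding slice_chart_def by simp
  then show ?thesis using c(2) that by blast
qed

lemma embedded_submanifoldI:
  fixes M :: "'a::{real_inner,banach} set"
  assumes "\<And>x. x \<in> M \<Longrightarrow> \<exists>F U V h k. slice_chart M F U V h k \<and> x \<in> U"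
  shows "C2_embedded_submanifold M"
  unfolding C2_embedded_submanifold_def
proof
  fix x assume "x \<in> M"
  then obtain F U V h k where c: "slice_chart M F U V h k" "x \<in> U" using assms by blast
  then have "open U" "open V" "subspace F" "closed F"
    unfolding slice_chart_def by (auto intro: C2_on_open)
  then have "open U \<and> x \<in> U \<and> open V \<and> C2_diffeomorphism U V h k \<and>
       subspace F \<and> closed F \<and> h ` (M \<inter> U) = F \<inter> V"
    using slice_chart_image[OF c(1)] slice_chart_diffeomorphism[OF c(1)] c(2) by (intro conjI)
  then show "\<exists>(U :: 'a set) (V :: 'a set) f g F. open U \<and> x \<in> U \<and> open V \<and> C2_diffeomorphism U V f g \<and>
       subspace F \<and> closed F \<and> f ` (M \<inter> U) = F \<inter> V"
    by (intro exI)
qed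

lemma slice_chart_C2_chart_at:
  assumes c: "slice_chart M F U V h k" and x: "x \<in> M" "x \<in> U"
  shows "C2_chart_at M x (M \<inter> U) F h"
proof -
  have o: "open U" "open V" and F: "subspace F" "closed F"
    using c unfolding slice_chart_def by (auto intro: C2_on_open)
  have "C2_diffeomorphism (M \<inter> U) (h ` (M \<inter> U)) h k"
    using slice_chart_diffeomorphism[OF c] unfolding C2_diffeomorphism_def
    by (auto intro: C2_map_subset simp: image_image)
  then show ?thesis
    unfolding C2_chart_at_def slice_chart_image[OF c] using o F x
    by (auto simp: openin_open_Int)
qed

lemma submanifold_ofI:
  assumes "N \<subseteq> M"
    and "\<And>x. x \<in> N \<Longrightarrow> \<exists>F G U V h k. slice_chart M F U V h k \<and> slice_chart N G U V h k \<and> G \<subseteq> F \<and> x \<in> U"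
  shows "C2_submanifold_of N M"
  unfolding C2_submanifold_of_def
proof (intro conjI ballI)
  show "N \<subseteq> M" by fact
  fix x assume x: "x \<in> N"
  obtain F G U V h k where c: "slice_chart M F U V h k" "slice_chart N G U V h k" "G \<subseteq> F" "x \<in> U"
    using assms(2)[OF x] by blast
  have "h ` (N \<inter> (M \<inter> U)) = h ` (N \<inter> U)" using \<open>N \<subseteq> M\<close> by (metis Int_assoc Int_absorb2)
  also have "\<dots> = G \<inter> h ` (M \<inter> U)"
    using slice_chart_image[OF c(1)] slice_chart_image[OF c(2)] c(3) by auto
  finally have "h ` (N \<inter> (M \<inter> U)) = G \<inter> h ` (M \<inter> U)" .
  moreover have "subspace G" "closed G" using c(2) unfolding slice_chart_def by auto
  moreover have "C2_chart_at M x (M \<inter> U) F h"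
    using slice_chart_C2_chart_at[OF c(1)] c(4) x \<open>N \<subseteq> M\<close> by blast
  ultimately show "\<exists>D F f G. C2_chart_at M x D F f \<and> subspace G \<and> closed G \<and> G \<subseteq> F \<and>
      f ` (N \<inter> D) = G \<inter> f ` D"
    using c(3) by - (rule exI[of _ "M \<inter> U"], rule exI[of _ F], rule exI[of _ h], rule exI[of _ G], simp)
qed

lemma inverse_derivatives:
  assumes "open U" "x \<in> U" "\<And>u. u \<in> U \<Longrightarrow> k (h u) = u"
    and h: "(h has_derivative h') (at x)" and k: "(k has_derivative k') (at (h x))"
  shows "k' (h' v) = v"
proof -
  have "((\<lambda>u. k (h u)) has_derivative (\<lambda>v. k' (h' v))) (at x)"
    using h k by (rule has_derivative_compose)
  then have "((\<lambda>u. u) has_derivative (\<lambda>v. k' (h' v))) (at x)"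
    by (rule has_derivative_transform_within_open[OF _ assms(1,2)]) (rule assms(3))
  then have "(\<lambda>v. k' (h' v)) = (\<lambda>v. v)" by (rule has_derivative_unique) (rule has_derivative_ident)
  then show ?thesis by (rule fun_cong)
qed

lemma vector_derivative_in_closed_subspace:
  assumes F: "subspace F" "closed F"
    and c: "(c has_vector_derivative w) (at 0)" "c 0 \<in> F" "\<forall>\<^sub>F t in at (0::real). c t \<in> F"
  shows "w \<in> F"
proof (rule Lim_in_closed_set[OF F(2)])
  show "\<forall>\<^sub>F t in at 0. (1 / t) *\<^sub>R (c t - c 0) \<in> F"
    using c(3) by eventually_elim (intro subspace_scale subspace_diff F c(2))
  have "((\<lambda>t. norm (c t - c 0 - t *\<^sub>R w) / norm t) \<longlongrightarrow> 0) (at 0)"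
    using c(1) by (simp add: has_vector_derivative_def has_derivative_iff_norm)
  moreover have "\<forall>\<^sub>F t in at 0. norm (c t - c 0 - t *\<^sub>R w) / norm t = norm ((1 / t) *\<^sub>R (c t - c 0) - w)"
    unfolding eventually_at_topological
  proof (intro exI[of _ UNIV] conjI ballI impI)
    fix t :: real assume "t \<noteq> 0"
    then have "(1 / t) *\<^sub>R (c t - c 0) - w = (1 / t) *\<^sub>R (c t - c 0 - t *\<^sub>R w)"
      by (simp add: scaleR_diff_right)
    then show "norm (c t - c 0 - t *\<^sub>R w) / norm t = norm ((1 / t) *\<^sub>R (c t - c 0) - w)"
      by simp
  qed auto
  ultimately have "((\<lambda>t. norm ((1 / t) *\<^sub>R (c t - c 0) - w)) \<longlongrightarrow> 0) (at 0)"
    by (rule Lim_transform_eventually)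
  then show "((\<lambda>t. (1 / t) *\<^sub>R (c t - c 0)) \<longlongrightarrow> w) (at 0)"
    by (simp add: tendsto_norm_zero_iff LIM_zero_iff)
qed simp

text \<open>
  A curve in \<open>M\<close> is carried by \<open>h\<close> into \<open>F\<close>, and velocities of curves in a closed subspace stay in it.
  Conversely, the inverse chart carries the segment through \<open>h x\<close> with direction \<open>h' v \<in> F\<close> to a curve
  in \<open>M\<close> with velocity \<open>v\<close>.
\<close>

lemma tangent_space_slice_chart:
  assumes c: "slice_chart M F U V h k" and x: "x \<in> M" "x \<in> U"
    and h': "(h has_derivative h') (at x)"
  shows "tangent_space M x = {v. h' v \<in> F}"
proof -
  have C: "C2_on h U" "C2_on k V" "h ` U = V" "k ` V = U"
    "\<And>x. x \<in> U \<Longrightarrow> k (h x) = x" "\<And>y. y \<in> V \<Longrightarrow> h (k y) = y"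
    "subspace F" "closed F" and mem: "\<And>x. x \<in> U \<Longrightarrow> h x \<in> F \<longleftrightarrow> x \<in> M"
    using c unfolding slice_chart_def by auto
  have o: "open U" "open V" using C(1,2) by (auto intro: C2_on_open)
  show ?thesis
  proof (intro set_eqI iffI CollectI)
    fix v assume "v \<in> tangent_space M x"
    then obtain \<gamma> e where e: "0 < e" "\<gamma> ` {-e<..<e} \<subseteq> M" and \<gamma>: "\<gamma> 0 = x" "(\<gamma> has_vector_derivative v) (at 0)"
      unfolding tangent_space_def curve_at_def by blast
    show "h' v \<in> F"
    proof (rule vector_derivative_in_closed_subspace[OF C(7,8)])
      have "((\<lambda>t. h (\<gamma> t)) has_derivative (\<lambda>t. h' (t *\<^sub>R v))) (at 0)"
        using \<gamma> h' unfolding has_vector_derivative_def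
        by - (rule has_derivative_compose, simp_all)
      then show "((\<lambda>t. h (\<gamma> t)) has_vector_derivative h' v) (at 0)"
        by (simp add: has_vector_derivative_def linear_scale[OF has_derivative_linear[OF h']])
      show "h (\<gamma> 0) \<in> F" using mem \<gamma>(1) x by simp
      have "(\<gamma> \<longlongrightarrow> \<gamma> 0) (at 0)"
        using has_vector_derivative_continuous[OF \<gamma>(2)] by (simp add: isCont_def)
      then have "\<forall>\<^sub>F t in at 0. \<gamma> t \<in> U" using o(1) x(2) \<gamma>(1) by (auto dest: topological_tendstoD)
      moreover have "\<forall>\<^sub>F t in at 0. t \<in> {-e<..<e}"
        using e(1) by (intro eventually_at_in_open') auto
      ultimately show "\<forall>\<^sub>F t in at 0. h (\<gamma> t) \<in> F"
        by eventually_elim (use mem e(2) in blast)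
    qed
  next
    fix v assume "v \<in> {v. h' v \<in> F}"
    then have w: "h' v \<in> F" by simp
    define w where "w = h' v"
    define l where "l t = h x + t *\<^sub>R w" for t :: real
    define \<gamma> where "\<gamma> t = k (l t)" for t
    obtain k' where k': "\<And>y. y \<in> V \<Longrightarrow> (k has_derivative blinfun_apply (k' y)) (at y)"
      "continuous_on V k'" using C2_on_imp_C1_on[OF C(2)] by (elim C1_onE) (rule that, simp_all)
    have l: "(l has_derivative (\<lambda>t. t *\<^sub>R w)) (at t)" for t
      unfolding l_def by (auto intro!: derivative_eq_intros)
    have cl: "continuous_on S l" for S unfolding l_def by (intro continuous_intros)
    have hx: "h x \<in> F" "h x \<in> V" using mem x C(3) by auto
    have "open (l -` V)" using cl o(2) by (intro open_vimage)
    moreover have "0 \<in> l -` V" using hx by (simp add: l_def)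
    ultimately obtain e where e: "0 < e" "ball 0 e \<subseteq> l -` V" by (meson openE)
    have lV: "l t \<in> V" if "t \<in> {-e<..<e}" for t
    proof -
      have "t \<in> ball 0 e" using that by (simp add: dist_real_def abs_less_iff)
      then show ?thesis using e(2) by blast
    qed
    have lF: "l t \<in> F" for t
      unfolding l_def w_def by (intro subspace_add subspace_scale C(7) hx w)
    have \<gamma>': "(\<gamma> has_vector_derivative k' (l t) w) (at t)" if "t \<in> {-e<..<e}" for t
      using has_derivative_compose[OF l k'(1)[OF lV[OF that]]]
      unfolding has_vector_derivative_def \<gamma>_def by (simp add: blinfun.scaleR_right)
    have "curve_at M x v \<gamma>"
      unfolding curve_at_def
    proof (intro conjI exI[of _ e] e(1))
      have "continuous_on {-e<..<e} (\<lambda>t. k' (l t) w)"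
        by (intro bounded_linear.continuous_on[OF blinfun.bounded_linear_left]
            continuous_on_compose2[OF k'(2) cl]) (use lV in auto)
      then show "\<gamma> C1_differentiable_on {-e<..<e}"
        unfolding C1_differentiable_on_def using \<gamma>' by (intro exI[of _ "\<lambda>t. k' (l t) w"]) blast
      show "\<gamma> ` {-e<..<e} \<subseteq> M"
      proof (rule image_subsetI)
        fix t assume t: "t \<in> {-e<..<e}"
        have "\<gamma> t \<in> U" unfolding \<gamma>_def using lV[OF t] C(4) by blast
        moreover have "h (\<gamma> t) \<in> F" unfolding \<gamma>_def using C(6)[OF lV[OF t]] lF by simp
        ultimately show "\<gamma> t \<in> M" using mem by blast
      qed
      show "\<gamma> 0 = x" using C(5) x by (simp add: \<gamma>_def l_def)
      have "k' (h x) w = v"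
        unfolding w_def by (rule inverse_derivatives[OF o(1) x(2) C(5) h' k'(1)[OF hx(2)]])
      then show "(\<gamma> has_vector_derivative v) (at 0)" using \<gamma>'[of 0] e(1) by (simp add: l_def)
    qed
    then show "v \<in> tangent_space M x" unfolding tangent_space_def by blast
  qed
qed

section \<open>Level sets of linear constraints\<close>

text \<open>
  The straightening step.  In the chart \<open>f\<close> the constraint reads \<open>B (g y) = c\<close> and has the linearization
  \<open>A\<close> at \<open>a = f x\<close>.  The right inverse \<open>R\<close> becomes a right inverse \<open>Q\<close> of \<open>A\<close> with values in \<open>F\<close>, and \<open>\<psi>\<close>
  corrects \<open>y - a\<close> by \<open>Q\<close> applied to the nonlinear part of the constraint.  Hence
  \<open>A (\<psi> y) = B (g y) - c\<close>, and the constraint becomes the linear condition \<open>A z = 0\<close>.  The correction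
  lies in \<open>F\<close>, so \<open>\<psi>\<close> preserves membership in \<open>F\<close>; and it vanishes to first order at \<open>a\<close>, so \<open>\<psi>\<close> is
  locally invertible and leaves the derivative of the chart at \<open>x\<close> unchanged.
\<close>

lemma level_set_slice_chart:
  fixes M :: "'a::banach set" and B :: "'a \<Rightarrow> 'b::real_normed_vector"
  assumes c: "slice_chart M F U V f g" and x: "x \<in> M" "x \<in> U" and B: "bounded_linear B" "B x = c"
    and R: "bounded_linear R" "\<And>y. R y \<in> tangent_space M x" "\<And>y. B (R y) = y"
  obtains U' W h k G h' where "x \<in> U'" "slice_chart M F U' W h k" "slice_chart {u \<in> M. B u = c} G U' W h k"
    "G \<subseteq> F" "(h has_derivative h') (at x)" "\<And>v. h' v \<in> G \<longleftrightarrow> h' v \<in> F \<and> B v = 0"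
proof -
  have C: "C2_on f U" "C2_on g V" "f ` U = V" "g ` V = U"
    "\<And>x. x \<in> U \<Longrightarrow> g (f x) = x" "\<And>y. y \<in> V \<Longrightarrow> f (g y) = y"
    and F: "subspace F" "closed F" and mem: "\<And>x. x \<in> U \<Longrightarrow> f x \<in> F \<longleftrightarrow> x \<in> M"
    using c unfolding slice_chart_def by auto
  have o: "open U" "open V" using C(1,2) by (auto intro: C2_on_open)
  define a where "a = f x"
  have a: "a \<in> V" "a \<in> F" using x mem C(3) by (auto simp: a_def)
  obtain f' where f': "(f has_derivative f') (at x)"
    using C2_on_imp_C1_on[OF C(1)] x(2) by (elim C1_onE) blast
  obtain g' where g': "(g has_derivative g') (at a)"
    using C2_on_imp_C1_on[OF C(2)] a(1) by (elim C1_onE) blast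
  have g'f': "g' (f' v) = v" for v
    by (rule inverse_derivatives[OF o(1) x(2) C(5) f' g'[unfolded a_def]])
  define A where "A y = B (g' y)" for y
  define Q where "Q y = f' (R y)" for y
  have A: "bounded_linear A" unfolding A_def
    by (rule bounded_linear_compose[OF B(1) has_derivative_bounded_linear[OF g']])
  have Q: "bounded_linear Q" unfolding Q_def
    by (rule bounded_linear_compose[OF has_derivative_bounded_linear[OF f'] R(1)])
  interpret A: bounded_linear A by fact
  interpret Q: bounded_linear Q by fact
  interpret B: bounded_linear B by fact
  have AQ: "A (Q y) = y" for y by (simp add: A_def Q_def g'f' R(3))
  have QF: "Q y \<in> F" for y
    using R(2)[of y] tangent_space_slice_chart[OF c x f'] by (simp add: Q_def)
  define \<psi> where "\<psi> y = (y - a) + Q (B (g y) - c - A (y - a))" for y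
  have A\<psi>: "A (\<psi> y) = B (g y) - c" for y by (simp add: \<psi>_def A.add AQ)
  have \<psi>F: "\<psi> y \<in> F \<longleftrightarrow> y \<in> F" for y
  proof
    assume "\<psi> y \<in> F"
    moreover have "y = \<psi> y - Q (B (g y) - c - A (y - a)) + a" by (simp add: \<psi>_def)
    ultimately show "y \<in> F" using F(1) QF a(2) by (metis subspace_add subspace_diff)
  next
    assume "y \<in> F"
    then show "\<psi> y \<in> F" unfolding \<psi>_def by (intro subspace_add subspace_diff F(1) QF a(2))
  qed
  have L: "bounded_linear (\<lambda>y. y - Q (A y))"
    by (intro bounded_linear_sub bounded_linear_ident bounded_linear_compose[OF Q A])
  have QB: "bounded_linear (\<lambda>y. Q (B y))" by (rule bounded_linear_compose[OF Q B(1)])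
  \<comment> \<open>Regrouped as an affine map plus a bounded linear map applied to \<open>g\<close>.\<close>
  have "C2_on (\<lambda>y. ((y - Q (A y)) + (Q (A a) - a - Q c)) + (Q (B (g y)) + 0)) V"
  proof (rule C2_on_add)
    show "C2_on (\<lambda>y. (y - Q (A y)) + (Q (A a) - a - Q c)) V"
      by (rule C2_on_subset[OF C2_on_affine[OF L]]) (use o in auto)
    show "C2_on (\<lambda>y. Q (B (g y)) + 0) V"
      by (rule C2_on_compose[OF C(2) C2_on_affine[OF QB]]) simp
  qed
  then have \<psi>C2: "C2_on \<psi> V"
    by (rule C2_on_cong) (simp add: \<psi>_def A.diff Q.add Q.diff algebra_simps)
  have "(\<psi> has_derivative (\<lambda>v. (v - 0) + Q (B (g' v) - 0 - A (v - 0)))) (at a)"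
    unfolding \<psi>_def
    by (intro has_derivative_add has_derivative_diff has_derivative_ident has_derivative_const
        Q.has_derivative A.has_derivative B.has_derivative g')
  then have d\<psi>: "(\<psi> has_derivative (\<lambda>v. v)) (at a)" by (simp add: A_def Q.zero)
  obtain V0 W \<theta> where \<theta>: "a \<in> V0" "V0 \<subseteq> V" "C2_on \<psi> V0" "C2_on \<theta> W" "\<psi> ` V0 = W" "\<theta> ` W = V0"
    "\<forall>y\<in>V0. \<theta> (\<psi> y) = y" "\<forall>z\<in>W. \<psi> (\<theta> z) = z"
    using C2_inverse_function[OF \<psi>C2 a(1) d\<psi>] by (elim exE conjE) (rule that)
  define U' where "U' = U \<inter> f -` V0"
  define h where "h u = \<psi> (f u)" for u
  define k where "k z = g (\<theta> z)" for z
  define G where "G = {z \<in> F. A z = 0}"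
  have oU': "open U'"
    unfolding U'_def Int_commute[of U] using o(1) C2_on_open[OF \<theta>(3)]
    by (intro continuous_on_open_vimage[THEN iffD1, rule_format] C1_on_continuous_on C2_on_imp_C1_on C(1))
  have U'U: "U' \<subseteq> U" and fU': "f ` U' \<subseteq> V0" by (auto simp: U'_def)
  have gV0: "g y \<in> U'" "f (g y) = y" if "y \<in> V0" for y
    using that \<theta>(2) C(4,6) by (auto simp: U'_def)
  have xU': "x \<in> U'" using x \<theta>(1) by (simp add: U'_def a_def)
  have hU': "h u \<in> W" "k (h u) = u" if "u \<in> U'" for u
  proof -
    have "f u \<in> V0" "u \<in> U" using that fU' U'U by auto
    then show "h u \<in> W" "k (h u) = u" using \<theta>(5,7) C(5) by (auto simp: h_def k_def)
  qed
  have kW: "k z \<in> U'" "h (k z) = z" if "z \<in> W" for z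
  proof -
    have "\<theta> z \<in> V0" using that \<theta>(6) by auto
    then show "k z \<in> U'" "h (k z) = z" using that \<theta>(8) gV0 by (auto simp: h_def k_def)
  qed
  have hC2: "C2_on h U'"
    unfolding h_def by (rule C2_on_compose[OF C2_on_subset[OF C(1) oU' U'U] \<theta>(3) fU'])
  have kC2: "C2_on k W"
    unfolding k_def by (rule C2_on_compose[OF \<theta>(4) C(2)]) (use \<theta>(2,6) in auto)
  have im: "h ` U' = W" "k ` W = U'"
    using hU' kW by (metis image_subsetI subset_antisym imageI subsetI)+
  have hF: "h u \<in> F \<longleftrightarrow> u \<in> M" if "u \<in> U'" for u
    using mem that U'U by (auto simp: h_def \<psi>F)
  have hG: "h u \<in> G \<longleftrightarrow> u \<in> {u \<in> M. B u = c}" if "u \<in> U'" for u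
    using hF[OF that] that U'U C(5)[of u] by (auto simp: G_def h_def A\<psi>)
  have "subspace G"
    unfolding G_def subspace_def using F(1)
    by (auto simp: subspace_0 subspace_add subspace_scale A.zero A.add A.scaleR)
  moreover have "closed G"
  proof -
    have "G = F \<inter> A -` {0}" by (auto simp: G_def)
    then show ?thesis
      using F(2) by (simp add: closed_Int closed_vimage A.continuous_on continuous_on_id)
  qed
  ultimately have sG: "slice_chart {u \<in> M. B u = c} G U' W h k"
    using hC2 kC2 im hU' kW hG unfolding slice_chart_def by blast
  have sF: "slice_chart M F U' W h k"
    using hC2 kC2 im hU' kW hF F unfolding slice_chart_def by blast
  have "(h has_derivative f') (at x)"
    unfolding h_def using has_derivative_compose[OF f' d\<psi>[unfolded a_def]] .
  moreover have "f' v \<in> G \<longleftrightarrow> f' v \<in> F \<and> B v = 0" for v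
    by (simp add: G_def A_def g'f')
  moreover have "G \<subseteq> F" by (auto simp: G_def)
  ultimately show ?thesis using that xU' sF sG by blast
qed

theorem corollary3p1:
  fixes M MB :: "'e::{real_inner,banach} set"
    and B :: "'e \<Rightarrow> 'y::{real_inner,banach}"
    and c :: 'y
    and P :: "'e \<Rightarrow> 'e \<Rightarrow> 'e"
  assumes "C2_embedded_submanifold M"
    and "bounded_linear B" and "surj B"
    and "MB = {x \<in> M. B x = c}" and "MB \<noteq> {}"
    and "\<And>x. x \<in> M \<Longrightarrow>
           bounded_linear (P x) \<and> range (P x) = tangent_space M x \<and> P x \<circ> P x = P x"
    and "\<And>x. x \<in> MB \<Longrightarrow> invertible_operator (B \<circ> P x \<circ> adjoint B)"
  shows "MB = M \<inter> B -` {c} \<and> MB = M \<inter> {x. B x = c} \<and>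
         C2_submanifold_of MB M \<and>
         C2_embedded_submanifold MB \<and>
         (\<forall>x\<in>MB. tangent_space MB x = tangent_map_kernel M B x \<and>
                  tangent_map_kernel M B x = tangent_space M x \<inter> {v. B v = 0})"
proof -
  have chart: "\<exists>U' W h k F G h'. x \<in> U' \<and> slice_chart M F U' W h k \<and> slice_chart MB G U' W h k \<and>
      G \<subseteq> F \<and> (h has_derivative h') (at x) \<and> (\<forall>v. h' v \<in> G \<longleftrightarrow> h' v \<in> F \<and> B v = 0)"
    if x: "x \<in> MB" for x
  proof -
    have xM: "x \<in> M" and Bx: "B x = c" using x assms(4) by auto
    obtain S where S: "bounded_linear S" "(B \<circ> P x \<circ> adjoint B) \<circ> S = id"
      using assms(7)[OF x] unfolding invertible_operator_def by blast
    \<comment> \<open>A bounded right inverse of \<open>B\<close> with values in the tangent space.\<close>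
    define R where "R y = P x (adjoint B (S y))" for y
    have P: "bounded_linear (P x)" "range (P x) = tangent_space M x" using assms(6)[OF xM] by auto
    have R: "bounded_linear R" "\<And>y. R y \<in> tangent_space M x" "\<And>y. B (R y) = y"
    proof -
      show "bounded_linear R" unfolding R_def
        by (intro bounded_linear_compose[OF P(1)] bounded_linear_compose[OF bounded_linear_adjoint]
            assms(2) S(1))
      show "R y \<in> tangent_space M x" for y using P(2) by (auto simp: R_def)
      show "B (R y) = y" for y using fun_cong[OF S(2), of y] by (simp add: R_def)
    qed
    obtain U V f g F where f: "slice_chart M F U V f g" "x \<in> U"
      by (rule embedded_submanifold_slice_chart[OF assms(1) xM])
    show ?thesis
      unfolding assms(4)
      by (rule level_set_slice_chart[OF f(1) xM f(2) assms(2) Bx R]) (intro exI conjI allI; assumption)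
  qed
  have "C2_submanifold_of MB M"
  proof (rule submanifold_ofI)
    show "MB \<subseteq> M" using assms(4) by blast
    show "\<exists>F G U V h k. slice_chart M F U V h k \<and> slice_chart MB G U V h k \<and> G \<subseteq> F \<and> x \<in> U"
      if "x \<in> MB" for x
      using chart[OF that] by (elim exE conjE) (intro exI conjI)
  qed
  moreover have "C2_embedded_submanifold MB"
  proof (rule embedded_submanifoldI)
    show "\<exists>F U V h k. slice_chart MB F U V h k \<and> x \<in> U" if "x \<in> MB" for x
      using chart[OF that] by (elim exE conjE) (intro exI conjI)
  qed
  moreover have tm: "tangent_map_kernel M B x = tangent_space M x \<inter> {v. B v = 0}" for x
    unfolding tangent_map_kernel_def using tangent_map_bounded_linear[OF assms(2)] by auto
  moreover have "tangent_space MB x = tangent_map_kernel M B x" if x: "x \<in> MB" for x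
  proof -
    obtain U' W h k F G h' where ch: "x \<in> U'" "slice_chart M F U' W h k" "slice_chart MB G U' W h k"
      "(h has_derivative h') (at x)" "\<forall>v. h' v \<in> G \<longleftrightarrow> h' v \<in> F \<and> B v = 0"
      using chart[OF x] by (elim exE conjE) (rule that)
    have xM: "x \<in> M" using x assms(4) by simp
    show ?thesis
      unfolding tm tangent_space_slice_chart[OF ch(2) xM ch(1,4)]
        tangent_space_slice_chart[OF ch(3) x ch(1,4)] using ch(5) by auto
  qed
  ultimately show ?thesis using assms(4) by auto
qed

end
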